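(* Let $R$ be the random walk in the quarter plane with homogeneous rates $q_{i,j},h_{i,j},v_{i,j},r_{i,j}$, and let $\bar\pi(n_1,n_2)=\sum_{k=1}^K c_k\rho_k^{n_1}\sigma_k^{n_2}$ be a probability distribution on $S$ that is a sum of geometric terms satisfying the interior balance equation of $R$ (see context). Choose constants $\bar h_{1,0},\bar v_{0,1}\ge 0$ and define the transition rates of a perturbed random walk $\bar R$ on $S$ as follows. Interior: $\bar q_{i,j}(n_1,n_2)=q_{i,j}$ for all $(n_1,n_2)\in S_4$, $(i,j)\in N_4$. Axes to interior: $\bar h_{i,1}(n_1,0)=q_{i,1}$ and $\bar v_{1,j}(0,n_2)=q_{1,j}$ for all $i,j\in\{-1,0,1\}$ and $n_1,n_2=1,2,\dots$. Origin: $\bar r_{1,0}=\bar h_{1,0}$, $\bar r_{0,1}=\bar v_{0,1}$, $\bar r_{1,1}=q_{1,1}$. Along the axes: for $n_1,n_2=1,2,\dots$, $\bar h_{1,0}(n_1,0)=\bar h_{1,0}$, $\bar v_{0,1}(0,n_2)=\bar v_{0,1}$, and $$\bar h_{-1,0}(n_1,0)=\frac{\sum_{k=1}^K c_k\rho_k^{n_1-1}}{\sum_{k=1}^K c_k\rho_k^{n_1}}\,\bar h_{1,0}-\frac{\sum_{k=1}^K c_k\alpha_k(1-\rho_k)^{-1}\rho_k^{n_1}}{\sum_{k=1}^K c_k\rho_k^{n_1}},$$ $$\bar v_{0,-1}(0,n_2)=\frac{\sum_{k=1}^K c_k\sigma_k^{n_2-1}}{\sum_{k=1}^K c_k\sigma_k^{n_2}}\,\bar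 v_{0,1}-\frac{\sum_{k=1}^K c_k\beta_k(1-\sigma_k)^{-1}\sigma_k^{n_2}}{\sum_{k=1}^K c_k\sigma_k^{n_2}},$$ where $$\alpha_k=\sum_{i=-1}^1 q_{i,1}-\sum_{i=-1}^1\rho_k^{-i}\sigma_k q_{i,-1},\qquad \beta_k=\sum_{j=-1}^1 q_{1,j}-\sum_{j=-1}^1\rho_k\sigma_k^{-j}q_{-1,j}.$$ Then $\bar\pi$ is the stationary probability distribution of $\bar R$, i.e. $\bar\pi$ satisfies the balance equations of $\bar R$ at every state of $S$.
   Context: State space and components: $S=\{0,1,2,\dots\}^2$; $S_1=\{1,2,\dots\}\times\{0\}$ (horizontal axis), $S_2=\{0\}\times\{1,2,\dots\}$ (vertical axis), $S_3=\{(0,0)\}$ (origin), $S_4=\{1,2,\dots\}^2$ (interior). Possible transitions: $N_1=(\{-1,0,1\}\times\{0,1\})\setminus\{(0,0)\}$, $N_2=(\{0,1\}\times\{-1,0,1\})\setminus\{(0,0)\}$, $N_3=(\{0,1\}\times\{0,1\})\setminus\{(0,0)\}$, $N_4=(\{-1,0,1\}\times\{-1,0,1\})\setminus\{(0,0)\}$. For $(n_1,n_2)\in S$, $N(n_1,n_2)=\{(i,j)\in\{-1,0,1\}^2 : (i,j)\ne(0,0),\ (n_1+i,n_2+j)\in S\}$. The walk $R$: a continuous-time random walk on $S$ whose transition rate from $(n_1,n_2)$ to $(n_1+i,n_2+j)$, $(i,j)\in N(n_1,n_2)$, is a nonnegative constant $h_{i,j}$, $v_{i,j}$, $r_{i,j}$,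 $q_{i,j}$ according to whether $(n_1,n_2)$ lies in $S_1,S_2,S_3,S_4$. $R$ is assumed irreducible, aperiodic and positive recurrent. Put $q_{0,0}=-\sum_{(i,j)\in N_4}q_{i,j}$. Sum of geometric terms satisfying the interior balance equation: $K\ge1$, $c_k\in\mathbb R$, $(\rho_k,\sigma_k)\in(0,1)^2$, the function $\bar\pi(n_1,n_2)=\sum_{k=1}^K c_k\rho_k^{n_1}\sigma_k^{n_2}$ is a probability distribution on $S$, and for each $k$ the measure $\rho_k^{n_1}\sigma_k^{n_2}$ satisfies the interior balance equation, i.e. $\sum_{i=-1}^1\sum_{j=-1}^1\rho_k^{-i}\sigma_k^{-j}q_{i,j}=0$. It is understood that the denominators $\sum_k c_k\rho_k^{n}$ and $\sum_k c_k\sigma_k^{n}$, $n\ge1$, are nonzero. The perturbed walk $\bar R$ lives on the same state space with the same possible transitions; its rate from $(n_1,n_2)$ to $(n_1+i,n_2+j)$ is written in general $\bar q_{i,j}(n_1,n_2)$, and is denoted $\bar h_{i,j}(n_1,0)$ on $S_1$, $\bar v_{i,j}(0,n_2)$ on $S_2$, $\bar r_{i,j}$ at the origin. Balance equation of $\bar R$ at $(n_1,n_2)$: $$\sum_{(i,j)\in N(n_1,n_2)}\bar\pi(n_1+i,n_2+j)\,\bar q_{-i,-j}(n_1+i,n_2+j)=\bar\pi(n_1,n_2)\sum_{(i,j)\in N(n_1,n_2)}\bar q_{i,j}(n_1,n_2).$$ A stationary probability distribution means a probability distribution on $S$ satisfying all balance equations. *)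

theory Defs
  imports "HOL-Analysis.Analysis"
begin

text \<open>States are pairs of naturals, so the state space \<open>S\<close> is the whole type.\<close>

type_synonym state = "nat \<times> nat"
type_synonym rates = "state \<Rightarrow> int \<times> int \<Rightarrow> real"

definition S1 :: "state set" where "S1 = {1..} \<times> {0}"
definition S2 :: "state set" where "S2 = {0} \<times> {1..}"
definition S3 :: "state set" where "S3 = {(0, 0)}"
definition S4 :: "state set" where "S4 = {1..} \<times> {1..}"

definition N1 :: "(int \<times> int) set" where "N1 = {-1, 0, 1} \<times> {0, 1} - {(0, 0)}"
definition N2 :: "(int \<times> int) set" where "N2 = {0, 1} \<times> {-1, 0, 1} - {(0, 0)}"
definition N3 :: "(int \<times> int) set" where "N3 = {0, 1} \<times> {0, 1} - {(0, 0)}"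
definition N4 :: "(int \<times> int) set" where "N4 = {-1, 0, 1} \<times> {-1, 0, 1} - {(0, 0)}"

definition N :: "state \<Rightarrow> (int \<times> int) set" where
  "N n = {(i, j). i \<in> {-1, 0, 1} \<and> j \<in> {-1, 0, 1} \<and> (i, j) \<noteq> (0, 0) \<and>
                  int (fst n) + i \<ge> 0 \<and> int (snd n) + j \<ge> 0}"

text \<open>Only used with \<open>d \<in> N n\<close>, where the truncation by \<open>nat\<close> has no effect.\<close>

definition step :: "state \<Rightarrow> int \<times> int \<Rightarrow> state" where
  "step n d = (nat (int (fst n) + fst d), nat (int (snd n) + snd d))"

text \<open>A walk is given by its rates: \<open>a n (i, j)\<close> is the rate from \<open>n\<close> to \<open>n + (i, j)\<close>, and is
  meaningful only for \<open>(i, j) \<in> N n\<close>.\<close>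

definition homogeneous_rates ::
  "(int \<times> int \<Rightarrow> real) \<Rightarrow> (int \<times> int \<Rightarrow> real) \<Rightarrow> (int \<times> int \<Rightarrow> real) \<Rightarrow> (int \<times> int \<Rightarrow> real) \<Rightarrow> rates"
where
  "homogeneous_rates h v r q n =
     (if n \<in> S1 then h else if n \<in> S2 then v else if n \<in> S3 then r else q)"

definition exit_rate :: "rates \<Rightarrow> state \<Rightarrow> real" where
  "exit_rate a n = (\<Sum>d\<in>N n. a n d)"

definition generator :: "rates \<Rightarrow> state \<Rightarrow> state \<Rightarrow> real" where
  "generator a x y = (if x = y then - exit_rate a x else (\<Sum>d | d \<in> N x \<and> step x d = y. a x d))"

text \<open>The states at distance at most one in each coordinate, \<open>n\<close> included
  (\<open>0 - 1 = 0\<close> on the naturals); all nonzero generator entries in the row or column of \<open>n\<close>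
  are there.\<close>

definition vicinity :: "state \<Rightarrow> state set" where
  "vicinity n = {fst n - 1..fst n + 1} \<times> {snd n - 1..snd n + 1}"

primrec generator_power :: "rates \<Rightarrow> nat \<Rightarrow> state \<Rightarrow> state \<Rightarrow> real" where
  "generator_power a 0 x y = (if x = y then 1 else 0)"
| "generator_power a (Suc m) x y = (\<Sum>z\<in>vicinity x. generator a x z * generator_power a m z y)"

text \<open>Transition function \<open>P(t) = exp (t Q)\<close> of the continuous-time chain. The series converges
  for rates that are bounded over the state space, in particular for homogeneous ones.\<close>

definition transition_prob :: "rates \<Rightarrow> real \<Rightarrow> state \<Rightarrow> state \<Rightarrow> real" where
  "transition_prob a t x y = (\<Sum>m. t ^ m / fact m * generator_power a m x y)"

definition irreducible_walk :: "rates \<Rightarrow> bool" where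
  "irreducible_walk a \<longleftrightarrow> (\<forall>x y. \<exists>t\<ge>0. transition_prob a t x y > 0)"

text \<open>Aperiodicity is that of the continuous-time chain, expressed through its discrete skeletons,
  not that of the embedded jump chain: the jump chain of a continuous-time walk may well be
  periodic.\<close>

definition aperiodic_walk :: "rates \<Rightarrow> bool" where
  "aperiodic_walk a \<longleftrightarrow>
     (\<forall>x. \<forall>\<delta>>0. Gcd {m::nat. m > 0 \<and> transition_prob a (real m * \<delta>) x x > 0} = 1)"

definition jump_prob :: "rates \<Rightarrow> state \<Rightarrow> state \<Rightarrow> real" where
  "jump_prob a x y = (if x = y then 0 else generator a x y / exit_rate a x)"

text \<open>\<open>taboo_prob a x m y\<close> is the probability that the jump chain started in \<open>x\<close> is in \<open>y\<close> after
  \<open>m\<close> jumps and has not returned to \<open>x\<close> at jumps \<open>1, \<dots>, m\<close>.\<close>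

primrec taboo_prob :: "rates \<Rightarrow> state \<Rightarrow> nat \<Rightarrow> state \<Rightarrow> real" where
  "taboo_prob a x 0 y = (if y = x then 1 else 0)"
| "taboo_prob a x (Suc m) y =
     (if y = x then 0 else (\<Sum>z\<in>vicinity y. taboo_prob a x m z * jump_prob a z y))"

text \<open>Expected time until the first return to \<open>x\<close>: the return time is the sum of the holding times
  before the jump chain returns, and a holding time in \<open>y\<close> has mean \<open>1 / exit_rate a y\<close>
  (infinite if \<open>y\<close> is absorbing).\<close>

definition mean_return_time :: "rates \<Rightarrow> state \<Rightarrow> ennreal" where
  "mean_return_time a x =
     (\<Sum>m. \<integral>\<^sup>+ y. ennreal (taboo_prob a x m y) / ennreal (exit_rate a y) \<partial>count_space UNIV)"

definition positive_recurrent_walk :: "rates \<Rightarrow> bool" where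
  "positive_recurrent_walk a \<longleftrightarrow> (\<forall>x. exit_rate a x = 0 \<or> mean_return_time a x < \<infinity>)"

definition prob_distribution :: "(state \<Rightarrow> real) \<Rightarrow> bool" where
  "prob_distribution p \<longleftrightarrow> (\<forall>n. p n \<ge> 0) \<and> (p has_sum 1) UNIV"

definition balance_at :: "rates \<Rightarrow> (state \<Rightarrow> real) \<Rightarrow> state \<Rightarrow> bool" where
  "balance_at a p n \<longleftrightarrow>
     (\<Sum>(i, j)\<in>N n. p (step n (i, j)) * a (step n (i, j)) (-i, -j)) = p n * (\<Sum>(i, j)\<in>N n. a n (i, j))"

definition stationary_distribution :: "rates \<Rightarrow> (state \<Rightarrow> real) \<Rightarrow> bool" where
  "stationary_distribution a p \<longleftrightarrow> prob_distribution p \<and> (\<forall>n. balance_at a p n)"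

definition geometric_sum ::
  "nat \<Rightarrow> (nat \<Rightarrow> real) \<Rightarrow> (nat \<Rightarrow> real) \<Rightarrow> (nat \<Rightarrow> real) \<Rightarrow> state \<Rightarrow> real" where
  "geometric_sum K c \<rho> \<sigma> n = (\<Sum>k=1..K. c k * \<rho> k ^ fst n * \<sigma> k ^ snd n)"

definition interior_balance :: "(int \<times> int \<Rightarrow> real) \<Rightarrow> real \<Rightarrow> real \<Rightarrow> bool" where
  "interior_balance q x y \<longleftrightarrow>
     (\<Sum>i=-1..1. \<Sum>j=-1..1. x powi (-i) * y powi (-j) * q (i, j)) = 0"

end

theory Submission
  imports Defs
begin

text \<open>
  At a state of the interior every neighbour sends its mass in at the rates \<open>q\<close>, because the rates
  from the axes and from the origin into the interior are those of \<open>q\<close>. Balance is therefore the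
  interior balance equation, one geometric term at a time, and linearity finishes it.

  On the horizontal axis write \<open>A n = \<Sum>k. c k * \<rho> k ^ n\<close> for the mass at \<open>(n, 0)\<close>
  and \<open>F n = \<Sum>k. c k * \<alpha> k / (1 - \<rho> k) * \<rho> k ^ n\<close>. The rate to the left is a
  quotient with denominator \<open>A n\<close>, chosen so that the flow from \<open>(n, 0)\<close> to \<open>(n - 1, 0)\<close> is
  \<open>A (n - 1) * h10 - F n\<close>: it cancels the flow in the opposite direction and leaves a net drift
  \<open>F n\<close> to the right. The number \<open>\<alpha> k\<close> is, relative to the mass on the axis, the upward
  loss to the interior minus the gain from it, for the \<open>k\<close>-th geometric term. The geometric series
  gives \<open>F n - F (n + 1) = \<Sum>k. c k * \<alpha> k * \<rho> k ^ n\<close>, so the drift \<open>F\<close> supplies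
  at each state exactly what is lost to the interior. The vertical axis is the mirror image.

  Only the origin is left, where nothing remains to be chosen. Balance must hold there because flow is
  conserved: summed over all states, inflow equals outflow, and every other state is balanced. For a
  single geometric term this conservation is a rational identity in \<open>\<rho> k\<close> and \<open>\<sigma> k\<close>,
  a consequence of the interior balance equation and of \<open>q\<close> summing to zero
  (\<open>origin_flow_of_geometric_term\<close>).
\<close>

section \<open>Balance equations written out\<close>

lemma N_interior:
  "N (Suc m, Suc l) = {(-1,-1), (-1,0), (-1,1), (0,-1), (0,1), (1,-1), (1,0), (1,1)}"
  by (auto simp: N_def)

lemma N_horizontal: "N (Suc m, 0) = {(-1,0), (-1,1), (0,1), (1,0), (1,1)}"
  by (auto simp: N_def)

lemma N_origin: "N (0, 0) = {(0,1), (1,0), (1,1)}"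
  by (auto simp: N_def)

lemma balance_at_interior_iff:
  "balance_at a p (Suc m, Suc l) \<longleftrightarrow>
     p (m, l) * a (m, l) (1, 1) + p (m, Suc l) * a (m, Suc l) (1, 0)
     + p (m, Suc (Suc l)) * a (m, Suc (Suc l)) (1, -1)
     + p (Suc m, l) * a (Suc m, l) (0, 1)
     + p (Suc m, Suc (Suc l)) * a (Suc m, Suc (Suc l)) (0, -1)
     + p (Suc (Suc m), l) * a (Suc (Suc m), l) (-1, 1)
     + p (Suc (Suc m), Suc l) * a (Suc (Suc m), Suc l) (-1, 0)
     + p (Suc (Suc m), Suc (Suc l)) * a (Suc (Suc m), Suc (Suc l)) (-1, -1)
   = p (Suc m, Suc l) * (\<Sum>d\<in>N (Suc m, Suc l). a (Suc m, Suc l) d)"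
  by (simp add: balance_at_def step_def N_interior nat_add_distrib algebra_simps)

lemma balance_at_horizontal_iff:
  "balance_at a p (Suc m, 0) \<longleftrightarrow>
     p (m, 0) * a (m, 0) (1, 0) + p (m, 1) * a (m, 1) (1, -1)
     + p (Suc m, 1) * a (Suc m, 1) (0, -1)
     + p (Suc (Suc m), 0) * a (Suc (Suc m), 0) (-1, 0)
     + p (Suc (Suc m), 1) * a (Suc (Suc m), 1) (-1, -1)
   = p (Suc m, 0) * (a (Suc m, 0) (-1, 0) + a (Suc m, 0) (1, 0)
       + (\<Sum>i=-1..1. a (Suc m, 0) (i, 1)))"
proof -
  have "{-1..1::int} = {-1, 0, 1}" by auto
  then show ?thesis
    by (simp add: balance_at_def step_def N_horizontal nat_add_distrib algebra_simps)
qed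

lemma balance_at_origin_iff:
  "balance_at a p (0, 0) \<longleftrightarrow>
     p (1, 0) * a (1, 0) (-1, 0) + p (0, 1) * a (0, 1) (0, -1) + p (1, 1) * a (1, 1) (-1, -1)
   = p (0, 0) * (a (0, 0) (1, 0) + a (0, 0) (0, 1) + a (0, 0) (1, 1))"
  by (simp add: balance_at_def step_def N_origin algebra_simps)

text \<open>Exchanging the two coordinates maps balance equations to balance equations; this carries
  results from the horizontal to the vertical axis.\<close>

lemma balance_at_swap:
  "balance_at (\<lambda>n d. a (prod.swap n) (prod.swap d)) (\<lambda>n. p (prod.swap n)) (m, l)
     \<longleftrightarrow> balance_at a p (l, m)"
proof -
  have N: "N (m, l) = prod.swap ` N (l, m)"
    by (auto simp: N_def image_iff)
  have inj: "inj_on prod.swap (N (l, m))"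
    by (rule inj_onI) (metis swap_swap)
  show ?thesis
    unfolding balance_at_def N sum.reindex[OF inj]
    by (simp add: case_prod_beta step_def)
qed

section \<open>Interior\<close>

lemma interior_balance_expanded:
  assumes "interior_balance q x y" "x \<noteq> 0" "y \<noteq> 0"
  shows "q (1, 1) + y * q (1, 0) + y^2 * q (1, -1) + x * q (0, 1) + x * y * q (0, 0)
    + x * y^2 * q (0, -1) + x^2 * q (-1, 1) + x^2 * y * q (-1, 0) + x^2 * y^2 * q (-1, -1) = 0"
proof -
  have ivl: "{-1..1::int} = {-1, 0, 1}" by auto
  have "0 = x * y * (\<Sum>i=-1..1. \<Sum>j=-1..1. x powi (-i) * y powi (-j) * q (i, j))"
    using assms(1) by (simp add: interior_balance_def)
  also have "\<dots> = q (1, 1) + y * q (1, 0) + y^2 * q (1, -1) + x * q (0, 1) + x * y * q (0, 0)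
    + x * y^2 * q (0, -1) + x^2 * q (-1, 1) + x^2 * y * q (-1, 0) + x^2 * y^2 * q (-1, -1)"
    using assms(2,3) by (simp add: ivl field_simps power2_eq_square)
  finally show ?thesis by simp
qed

lemma balance_at_interior:
  assumes nonzero: "\<And>k. k \<in> {1..K} \<Longrightarrow> \<rho> k \<noteq> 0 \<and> \<sigma> k \<noteq> 0"
    and interior: "\<And>k. k \<in> {1..K} \<Longrightarrow> interior_balance q (\<rho> k) (\<sigma> k)"
    and q00: "q (0, 0) = - (\<Sum>d\<in>N4. q d)"
    and rates: "\<And>n d. n \<in> S4 \<Longrightarrow> d \<in> N4 \<Longrightarrow> a n d = q d"
    and up: "\<And>n i. n \<ge> 1 \<Longrightarrow> i \<in> {-1, 0, 1} \<Longrightarrow> a (n, 0) (i, 1) = q (i, 1)"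
    and right: "\<And>n j. n \<ge> 1 \<Longrightarrow> j \<in> {-1, 0, 1} \<Longrightarrow> a (0, n) (1, j) = q (1, j)"
    and origin: "a (0, 0) (1, 1) = q (1, 1)"
  shows "balance_at a (geometric_sum K c \<rho> \<sigma>) (Suc m, Suc l)"
proof -
  let ?p = "geometric_sum K c \<rho> \<sigma>"
  have into_right: "a (x, Suc y) (1, j) = q (1, j)" if "j \<in> {-1, 0, 1}" for x y j
    using that rates[of "(x, Suc y)" "(1, j)"] right[of "Suc y" j]
    by (cases x) (auto simp: S4_def N4_def)
  have into_up: "a (Suc x, y) (i, 1) = q (i, 1)" if "i \<in> {-1, 0, 1}" for x y i
    using that rates[of "(Suc x, y)" "(i, 1)"] up[of "Suc x" i]
    by (cases y) (auto simp: S4_def N4_def)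
  have diagonal: "a (m, l) (1, 1) = q (1, 1)"
    using into_right[of 1 m "l - 1"] into_up[of 1 "m - 1" l] origin by (cases m; cases l) auto
  have out: "(\<Sum>d\<in>N (Suc m, Suc l). a (Suc m, Suc l) d) = - q (0, 0)"
  proof -
    have "N (Suc m, Suc l) = N4" by (auto simp: N_interior N4_def)
    then show ?thesis
      using rates[of "(Suc m, Suc l)"] by (simp add: q00 S4_def)
  qed
  have term_balance: "c k * \<rho> k ^ m * \<sigma> k ^ l * (q (1, 1) + \<sigma> k * q (1, 0)
      + \<sigma> k ^ 2 * q (1, -1) + \<rho> k * q (0, 1) + \<rho> k * \<sigma> k * q (0, 0)
      + \<rho> k * \<sigma> k ^ 2 * q (0, -1) + \<rho> k ^ 2 * q (-1, 1) + \<rho> k ^ 2 * \<sigma> k * q (-1, 0)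
      + \<rho> k ^ 2 * \<sigma> k ^ 2 * q (-1, -1)) = 0" if "k \<in> {1..K}" for k
    using interior_balance_expanded[OF interior[OF that]] nonzero[OF that] by simp
  have "?p (m, l) * q (1, 1) + ?p (m, Suc l) * q (1, 0) + ?p (m, Suc (Suc l)) * q (1, -1)
      + ?p (Suc m, l) * q (0, 1) + ?p (Suc m, Suc l) * q (0, 0)
      + ?p (Suc m, Suc (Suc l)) * q (0, -1) + ?p (Suc (Suc m), l) * q (-1, 1)
      + ?p (Suc (Suc m), Suc l) * q (-1, 0) + ?p (Suc (Suc m), Suc (Suc l)) * q (-1, -1) = 0"
    unfolding geometric_sum_def sum_distrib_right sum.distrib[symmetric]
    by (rule sum.neutral, rule ballI)
      (use term_balance in \<open>simp add: algebra_simps power2_eq_square\<close>)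
  moreover have "a (Suc m, Suc (Suc l)) (0, -1) = q (0, -1)"
      "a (Suc (Suc m), Suc l) (-1, 0) = q (-1, 0)"
      "a (Suc (Suc m), Suc (Suc l)) (-1, -1) = q (-1, -1)"
    by (auto intro!: rates simp: S4_def N4_def)
  ultimately show ?thesis
    unfolding balance_at_interior_iff out
    using diagonal into_right into_up by (simp add: algebra_simps)
qed

section \<open>Axes\<close>

text \<open>The rate along the axis enters the balance equations only through this flow: the part
  \<open>B * \<eta>\<close> cancels the flow in the opposite direction, the rest is a net drift away from the
  origin.\<close>

lemma axis_flow_towards_origin:
  fixes A drift :: real
  assumes "A \<noteq> 0" "rate = B / A * \<eta> - drift / A"
  shows "A * rate = B * \<eta> - drift"
  using assms by (simp add: field_simps)

text \<open>The neighbours of \<open>(1, 0)\<close> include the origin and the state \<open>(0, 1)\<close> of the other axis, so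
  the rates \<open>(1, 0)\<close> and \<open>(1, -1)\<close> are prescribed from column \<open>0\<close> on, and all others only from
  column \<open>1\<close> on.\<close>

lemma balance_at_horizontal:
  assumes \<rho>: "\<And>k. k \<in> {1..K} \<Longrightarrow> 0 < \<rho> k \<and> \<rho> k < 1"
    and denom: "\<And>n. n \<ge> 1 \<Longrightarrow> (\<Sum>k=1..K. c k * \<rho> k ^ n) \<noteq> 0"
    and \<alpha>: "\<And>k. k \<in> {1..K} \<Longrightarrow> \<alpha> k =
          (\<Sum>i=-1..1. q (i, 1)) - (\<Sum>i=-1..1. \<rho> k powi (-i) * \<sigma> k * q (i, -1))"
    and down: "\<And>n i. i \<in> {-1, 0} \<Longrightarrow> n \<ge> 1 \<Longrightarrow> a (n, 1) (i, -1) = q (i, -1)"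
    and down_right: "\<And>n. a (n, 1) (1, -1) = q (1, -1)"
    and up: "\<And>n i. n \<ge> 1 \<Longrightarrow> i \<in> {-1, 0, 1} \<Longrightarrow> a (n, 0) (i, 1) = q (i, 1)"
    and right: "\<And>n. a (n, 0) (1, 0) = \<eta>"
    and left: "\<And>n. n \<ge> 1 \<Longrightarrow> a (n, 0) (-1, 0) =
          (\<Sum>k=1..K. c k * \<rho> k ^ (n - 1)) / (\<Sum>k=1..K. c k * \<rho> k ^ n) * \<eta>
          - (\<Sum>k=1..K. c k * \<alpha> k * inverse (1 - \<rho> k) * \<rho> k ^ n) / (\<Sum>k=1..K. c k * \<rho> k ^ n)"
  shows "balance_at a (geometric_sum K c \<rho> \<sigma>) (Suc m, 0)"
proof -
  let ?p = "geometric_sum K c \<rho> \<sigma>"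
  define drift where
    "drift n = (\<Sum>k=1..K. c k * \<alpha> k * inverse (1 - \<rho> k) * \<rho> k ^ n)" for n
  have ivl: "{-1..1::int} = {-1, 0, 1}" by auto
  have p_axis: "?p (n, 0) = (\<Sum>k=1..K. c k * \<rho> k ^ n)" for n
    by (simp add: geometric_sum_def)
  have flow: "?p (Suc n, 0) * a (Suc n, 0) (-1, 0) = ?p (n, 0) * \<eta> - drift (Suc n)" for n
    unfolding p_axis
    by (rule axis_flow_towards_origin) (use denom[of "Suc n"] left[of "Suc n"] in \<open>auto simp: drift_def\<close>)
  \<comment> \<open>The geometric series, in the form \<open>1 / (1 - x) - x / (1 - x) = 1\<close>.\<close>
  have drift_drop: "drift (Suc m) - drift (Suc (Suc m)) = (\<Sum>k=1..K. c k * \<alpha> k * \<rho> k ^ Suc m)"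
    unfolding drift_def sum_subtractf[symmetric]
  proof (rule sum.cong[OF refl])
    fix k assume "k \<in> {1..K}"
    then have geometric: "inverse (1 - \<rho> k) * (1 - \<rho> k) = 1" using \<rho>[of k] by simp
    have "c k * \<alpha> k * inverse (1 - \<rho> k) * \<rho> k ^ Suc m
        - c k * \<alpha> k * inverse (1 - \<rho> k) * \<rho> k ^ Suc (Suc m)
      = c k * \<alpha> k * \<rho> k ^ Suc m * (inverse (1 - \<rho> k) * (1 - \<rho> k))"
      by (simp add: algebra_simps)
    with geometric show "c k * \<alpha> k * inverse (1 - \<rho> k) * \<rho> k ^ Suc m
        - c k * \<alpha> k * inverse (1 - \<rho> k) * \<rho> k ^ Suc (Suc m) = c k * \<alpha> k * \<rho> k ^ Suc m"
      by simp
  qed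
  have exchange: "(\<Sum>k=1..K. c k * \<alpha> k * \<rho> k ^ Suc m) =
      ?p (Suc m, 0) * (\<Sum>i=-1..1. q (i, 1))
      - (?p (m, 1) * q (1, -1) + ?p (Suc m, 1) * q (0, -1) + ?p (Suc (Suc m), 1) * q (-1, -1))"
    unfolding geometric_sum_def sum_distrib_right sum.distrib[symmetric] sum_subtractf[symmetric]
  proof (rule sum.cong[OF refl])
    fix k assume k: "k \<in> {1..K}"
    then have "\<rho> k \<noteq> 0" using \<rho>[of k] by auto
    then show "c k * \<alpha> k * \<rho> k ^ Suc m =
        c k * \<rho> k ^ fst (Suc m, 0::nat) * \<sigma> k ^ snd (Suc m, 0::nat) * (\<Sum>i=-1..1. q (i, 1))
        - (c k * \<rho> k ^ fst (m, 1::nat) * \<sigma> k ^ snd (m, 1::nat) * q (1, -1)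
          + c k * \<rho> k ^ fst (Suc m, 1::nat) * \<sigma> k ^ snd (Suc m, 1::nat) * q (0, -1)
          + c k * \<rho> k ^ fst (Suc (Suc m), 1::nat) * \<sigma> k ^ snd (Suc (Suc m), 1::nat) * q (-1, -1))"
      unfolding \<alpha>[OF k] by (simp add: ivl field_simps)
  qed
  have "(\<Sum>i=-1..1. a (Suc m, 0) (i, 1)) = (\<Sum>i=-1..1. q (i, 1))"
    using up by (intro sum.cong) (auto simp: ivl)
  then show ?thesis
    unfolding balance_at_horizontal_iff
    using flow[of m] flow[of "Suc m"] drift_drop exchange
    by (simp add: right down down_right distrib_left del: One_nat_def)
qed

section \<open>Origin\<close>

text \<open>Conservation of flow for the single term \<open>x ^ n1 * y ^ n2\<close>: inflow into the origin on the
  left, outflow on the right. The two subtracted terms are the net drifts out along the axes; the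
  flows \<open>h10\<close> and \<open>v01\<close> have cancelled. After multiplication by \<open>(1 - x) * (1 - y)\<close> the difference
  of the two sides is a linear combination, with polynomial coefficients, of the interior balance
  equation and of the sum of all \<open>q\<close>, both zero.\<close>

lemma origin_flow_of_geometric_term:
  fixes x y :: real and q :: "int \<times> int \<Rightarrow> real"
  assumes x: "0 < x" "x < 1" and y: "0 < y" "y < 1"
    and interior: "interior_balance q x y"
    and q00: "q (0, 0) = - (\<Sum>d\<in>N4. q d)"
    and \<alpha>: "\<alpha> = (\<Sum>i=-1..1. q (i, 1)) - (\<Sum>i=-1..1. x powi (-i) * y * q (i, -1))"
    and \<beta>: "\<beta> = (\<Sum>j=-1..1. q (1, j)) - (\<Sum>j=-1..1. x * y powi (-j) * q (-1, j))"
  shows "x * y * q (-1, -1) - \<alpha> * inverse (1 - x) * x - \<beta> * inverse (1 - y) * y = q (1, 1)"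
proof -
  have ivl: "{-1..1::int} = {-1, 0, 1}" by auto
  have N4: "N4 = {(-1,-1), (-1,0), (-1,1), (0,-1), (0,1), (1,-1), (1,0), (1,1)}"
    by (auto simp: N4_def)
  have \<alpha>x: "\<alpha> * x = x * (q (-1, 1) + q (0, 1) + q (1, 1))
      - y * (x^2 * q (-1, -1) + x * q (0, -1) + q (1, -1))"
    using x by (simp add: \<alpha> ivl field_simps power2_eq_square)
  have \<beta>y: "\<beta> * y = y * (q (1, -1) + q (1, 0) + q (1, 1))
      - x * (y^2 * q (-1, -1) + y * q (-1, 0) + q (-1, 1))"
    using y by (simp add: \<beta> ivl field_simps power2_eq_square)
  have "(1 - x) * (1 - y) * (x * y * q (-1, -1) - q (1, 1)) = \<alpha> * x * (1 - y) + \<beta> * y * (1 - x)"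
  proof -
    have bal: "q (1, 1) + y * q (1, 0) + y^2 * q (1, -1) + x * q (0, 1) + x * y * q (0, 0)
      + x * y^2 * q (0, -1) + x^2 * q (-1, 1) + x^2 * y * q (-1, 0) + x^2 * y^2 * q (-1, -1) = 0"
      using interior_balance_expanded[OF interior] x y by simp
    have q00': "q (0, 0) = - (q (-1,-1) + q (-1,0) + q (-1,1) + q (0,-1) + q (0,1)
        + q (1,-1) + q (1,0) + q (1,1))"
      unfolding q00 N4 by simp
    show ?thesis
      unfolding \<alpha>x \<beta>y using bal unfolding q00' by algebra
  qed
  then have "x * y * q (-1, -1) - q (1, 1) = (\<alpha> * x * (1 - y) + \<beta> * y * (1 - x)) / ((1 - x) * (1 - y))"
    using x y by (simp add: nonzero_eq_divide_eq mult.commute)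
  also have "\<dots> = \<alpha> * inverse (1 - x) * x + \<beta> * inverse (1 - y) * y"
    using x y add_frac_eq[of "1 - x" "1 - y" "\<alpha> * x" "\<beta> * y"] by (simp add: divide_inverse mult_ac)
  finally show ?thesis by simp
qed

section \<open>The perturbed walk\<close>

theorem theorem3p1:
  fixes h v r q :: "int \<times> int \<Rightarrow> real"
    and K :: nat and c \<rho> \<sigma> \<alpha> \<beta> :: "nat \<Rightarrow> real"
    and h10 v01 :: real
    and qbar :: rates
  assumes h_nonneg: "\<forall>d\<in>N1. h d \<ge> 0"
    and v_nonneg: "\<forall>d\<in>N2. v d \<ge> 0"
    and r_nonneg: "\<forall>d\<in>N3. r d \<ge> 0"
    and q_nonneg: "\<forall>d\<in>N4. q d \<ge> 0"
    and q00: "q (0, 0) = - (\<Sum>d\<in>N4. q d)"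
    and irreducible: "irreducible_walk (homogeneous_rates h v r q)"
    and aperiodic: "aperiodic_walk (homogeneous_rates h v r q)"
    and positive_recurrent: "positive_recurrent_walk (homogeneous_rates h v r q)"
    and K: "K \<ge> 1"
    and \<rho>: "\<forall>k\<in>{1..K}. 0 < \<rho> k \<and> \<rho> k < 1"
    and \<sigma>: "\<forall>k\<in>{1..K}. 0 < \<sigma> k \<and> \<sigma> k < 1"
    and prob: "prob_distribution (geometric_sum K c \<rho> \<sigma>)"
    and interior: "\<forall>k\<in>{1..K}. interior_balance q (\<rho> k) (\<sigma> k)"
    and \<rho>_denom: "\<forall>n\<ge>1. (\<Sum>k=1..K. c k * \<rho> k ^ n) \<noteq> 0"
    and \<sigma>_denom: "\<forall>n\<ge>1. (\<Sum>k=1..K. c k * \<sigma> k ^ n) \<noteq> 0"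
    and h10: "h10 \<ge> 0"
    and v01: "v01 \<ge> 0"
    and \<alpha>: "\<forall>k\<in>{1..K}. \<alpha> k =
          (\<Sum>i=-1..1. q (i, 1)) - (\<Sum>i=-1..1. \<rho> k powi (-i) * \<sigma> k * q (i, -1))"
    and \<beta>: "\<forall>k\<in>{1..K}. \<beta> k =
          (\<Sum>j=-1..1. q (1, j)) - (\<Sum>j=-1..1. \<rho> k * \<sigma> k powi (-j) * q (-1, j))"
    and qbar_interior: "\<forall>n\<in>S4. \<forall>d\<in>N4. qbar n d = q d"
    and hbar_up: "\<forall>n1\<ge>1. \<forall>i\<in>{-1, 0, 1}. qbar (n1, 0) (i, 1) = q (i, 1)"
    and vbar_right: "\<forall>n2\<ge>1. \<forall>j\<in>{-1, 0, 1}. qbar (0, n2) (1, j) = q (1, j)"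
    and rbar: "qbar (0, 0) (1, 0) = h10" "qbar (0, 0) (0, 1) = v01" "qbar (0, 0) (1, 1) = q (1, 1)"
    and hbar_right: "\<forall>n1\<ge>1. qbar (n1, 0) (1, 0) = h10"
    and vbar_up: "\<forall>n2\<ge>1. qbar (0, n2) (0, 1) = v01"
    and hbar_left: "\<forall>n1\<ge>1. qbar (n1, 0) (-1, 0) =
          (\<Sum>k=1..K. c k * \<rho> k ^ (n1 - 1)) / (\<Sum>k=1..K. c k * \<rho> k ^ n1) * h10
          - (\<Sum>k=1..K. c k * \<alpha> k * inverse (1 - \<rho> k) * \<rho> k ^ n1) / (\<Sum>k=1..K. c k * \<rho> k ^ n1)"
    and vbar_down: "\<forall>n2\<ge>1. qbar (0, n2) (0, -1) =
          (\<Sum>k=1..K. c k * \<sigma> k ^ (n2 - 1)) / (\<Sum>k=1..K. c k * \<sigma> k ^ n2) * v01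
          - (\<Sum>k=1..K. c k * \<beta> k * inverse (1 - \<sigma> k) * \<sigma> k ^ n2) / (\<Sum>k=1..K. c k * \<sigma> k ^ n2)"
  shows "stationary_distribution qbar (geometric_sum K c \<rho> \<sigma>)"
proof -
  let ?p = "geometric_sum K c \<rho> \<sigma>"
  have down: "qbar (n, 1) (i, -1) = q (i, -1)" if "i \<in> {-1, 0}" "n \<ge> 1" for n i
    using that qbar_interior by (auto simp: S4_def N4_def)
  have down_right: "qbar (n, 1) (1, -1) = q (1, -1)" for n
    using qbar_interior vbar_right by (cases n) (auto simp: S4_def N4_def)
  have leftward: "qbar (1, n) (-1, j) = q (-1, j)" if "j \<in> {-1, 0}" "n \<ge> 1" for n j
    using that qbar_interior by (auto simp: S4_def N4_def)
  have leftward_up: "qbar (1, n) (-1, 1) = q (-1, 1)" for n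
    using qbar_interior hbar_up by (cases n) (auto simp: S4_def N4_def)
  have right: "qbar (n, 0) (1, 0) = h10" for n
    using hbar_right rbar by (cases n) auto
  have above: "qbar (0, n) (0, 1) = v01" for n
    using vbar_up rbar by (cases n) auto

  have interior_states: "balance_at qbar ?p (Suc m, Suc l)" for m l
    by (rule balance_at_interior[where q = q])
      (use \<rho> \<sigma> interior q00 qbar_interior hbar_up vbar_right rbar in \<open>auto simp: less_imp_neq[symmetric]\<close>)
  have horizontal: "balance_at qbar ?p (Suc m, 0)" for m
    by (rule balance_at_horizontal[where q = q and \<alpha> = \<alpha> and \<eta> = h10])
      (use \<rho> \<rho>_denom \<alpha> down down_right hbar_up right hbar_left in blast)+
  have vertical: "balance_at qbar ?p (0, Suc m)" for m
  proof -
    let ?a = "\<lambda>n d. qbar (prod.swap n) (prod.swap d)"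
    have "balance_at ?a (geometric_sum K c \<sigma> \<rho>) (Suc m, 0)"
    proof (rule balance_at_horizontal[where q = "\<lambda>d. q (prod.swap d)" and \<alpha> = \<beta> and \<eta> = v01])
      show "\<beta> k = (\<Sum>j=-1..1. q (prod.swap (j, 1)))
          - (\<Sum>j=-1..1. \<sigma> k powi (-j) * \<rho> k * q (prod.swap (j, -1)))" if "k \<in> {1..K}" for k
        using \<beta> that by (simp add: mult.commute)
    qed (use \<sigma> \<sigma>_denom leftward leftward_up vbar_right above vbar_down in auto)
    moreover have "geometric_sum K c \<sigma> \<rho> = (\<lambda>n. ?p (prod.swap n))"
      by (auto simp: fun_eq_iff geometric_sum_def mult_ac)
    ultimately show ?thesis by (simp only: balance_at_swap)
  qed
  have origin: "balance_at qbar ?p (0, 0)"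
  proof -
    have p: "?p (n, 0) = (\<Sum>k=1..K. c k * \<rho> k ^ n)" "?p (0, n) = (\<Sum>k=1..K. c k * \<sigma> k ^ n)" for n
      by (simp_all add: geometric_sum_def)
    have from_right: "?p (1, 0) * qbar (1, 0) (-1, 0) =
        ?p (0, 0) * h10 - (\<Sum>k=1..K. c k * \<alpha> k * inverse (1 - \<rho> k) * \<rho> k)"
      unfolding p(1) by (rule axis_flow_towards_origin) (use \<rho>_denom[rule_format, of 1] hbar_left[rule_format, of 1] in auto)
    have from_above: "?p (0, 1) * qbar (0, 1) (0, -1) =
        ?p (0, 0) * v01 - (\<Sum>k=1..K. c k * \<beta> k * inverse (1 - \<sigma> k) * \<sigma> k)"
      unfolding p(2) by (rule axis_flow_towards_origin) (use \<sigma>_denom[rule_format, of 1] vbar_down[rule_format, of 1] in auto)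
    have "?p (1, 1) * q (-1, -1) - (\<Sum>k=1..K. c k * \<alpha> k * inverse (1 - \<rho> k) * \<rho> k)
        - (\<Sum>k=1..K. c k * \<beta> k * inverse (1 - \<sigma> k) * \<sigma> k) = ?p (0, 0) * q (1, 1)"
      unfolding geometric_sum_def sum_distrib_right sum_subtractf[symmetric]
    proof (rule sum.cong[OF refl])
      fix k assume k: "k \<in> {1..K}"
      have "\<rho> k * \<sigma> k * q (-1, -1) - \<alpha> k * inverse (1 - \<rho> k) * \<rho> k
          - \<beta> k * inverse (1 - \<sigma> k) * \<sigma> k = q (1, 1)"
        by (rule origin_flow_of_geometric_term) (use k \<rho> \<sigma> interior q00 \<alpha> \<beta> in blast)+
      from arg_cong[OF this, of "\<lambda>z. c k * z"]
      show "c k * \<rho> k ^ fst (1::nat, 1::nat) * \<sigma> k ^ snd (1::nat, 1::nat) * q (-1, -1)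
          - c k * \<alpha> k * inverse (1 - \<rho> k) * \<rho> k - c k * \<beta> k * inverse (1 - \<sigma> k) * \<sigma> k
        = c k * \<rho> k ^ fst (0::nat, 0::nat) * \<sigma> k ^ snd (0::nat, 0::nat) * q (1, 1)"
        by (simp add: algebra_simps)
    qed
    with from_right from_above show ?thesis
      unfolding balance_at_origin_iff
      using down[of "-1" 1] by (simp add: rbar distrib_left)
  qed
  have "balance_at qbar ?p (m, l)" for m l
    using interior_states horizontal vertical origin by (cases m; cases l) auto
  then show ?thesis
    using prob by (auto simp: stationary_distribution_def)
qed

end
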